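(* An element $x=x_0.x_1x_2x_3\cdots\in\mathcal R$ is irrational if and only if it does not end with infinite recurrence of a block of digits (that is, there do not exist integers $m\ge 0$ and $s\ge 1$ such that $x_{k+s}=x_k$ for all $k>m$).
   Context: $\mathbb N=\{1,2,3,\dots\}$ and $\mathcal Z_{10}=\{0,1,\dots,9\}$. $\mathcal R$ is the set of all formal decimals $x=x_0.x_1x_2x_3\cdots$ with $x_0\in\mathbb Z$ and $x_k\in\mathcal Z_{10}$ for $k\in\mathbb N$; two elements are equal iff all their digits agree. $\mathbb Q$ is regarded as a subset of $\mathcal R$ via long division: $\alpha=q/p$ ($p\in\mathbb N$, $q\in\mathbb Z$) is identified with $\alpha_0.\alpha_1\alpha_2\cdots$, where $\alpha_0=\lfloor q/p\rfloor$, $\beta_0=q-\alpha_0p$, $\alpha_{k+1}=\lfloor 10\beta_k/p\rfloor$, $\beta_{k+1}=10\beta_k-\alpha_{k+1}p$. $\mathcal R_9\subset\mathcal R$ is the set of all decimals ending in an infinite string of nines. An element of $\mathcal R$ is called irrational if it belongs neither to $\mathbb Q$ (viewed as a subset of $\mathcal R$ by identifying each rational number $\alpha=q/p$ with its long-division decimal $\alpha_0.\alpha_1\alpha_2\cdots$) nor to $\mathcal R_9$. *)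

theory Defs
  imports Complex_Main
begin

text \<open>
  A formal decimal \<open>x\<^sub>0.x\<^sub>1x\<^sub>2x\<^sub>3\<dots>\<close> is the sequence of its digits, so that
  equality of functions is equality of all digits. The integer part \<open>x 0\<close> is unrestricted.
\<close>

definition decimals :: "(nat \<Rightarrow> int) set" where
  "decimals = {x. \<forall>k\<ge>1. x k \<in> {0..9}}"

text \<open>
  The digits \<open>\<alpha>\<^sub>k\<close> and the remainders \<open>\<beta>\<^sub>k\<close> of the long division of \<open>q\<close> by \<open>p\<close>.
\<close>

fun ldiv_digit :: "int \<Rightarrow> nat \<Rightarrow> nat \<Rightarrow> int"
  and ldiv_rem :: "int \<Rightarrow> nat \<Rightarrow> nat \<Rightarrow> int" where
  "ldiv_digit q p 0 = \<lfloor>(of_int q / of_nat p :: rat)\<rfloor>"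
| "ldiv_digit q p (Suc k) = \<lfloor>(of_int (10 * ldiv_rem q p k) / of_nat p :: rat)\<rfloor>"
| "ldiv_rem q p 0 = q - ldiv_digit q p 0 * int p"
| "ldiv_rem q p (Suc k) = 10 * ldiv_rem q p k - ldiv_digit q p (Suc k) * int p"

text \<open>
  The image of the rationals: the fraction \<open>q/p\<close> need not be in lowest terms;
  by \<open>ldiv_digit_cong\<close> below, its decimal depends only on the value of the fraction.
\<close>

definition rational_decimals :: "(nat \<Rightarrow> int) set" where
  "rational_decimals = {ldiv_digit q p | q p. p \<ge> 1}"

definition nines_decimals :: "(nat \<Rightarrow> int) set" where
  "nines_decimals = {x \<in> decimals. \<exists>m. \<forall>k>m. x k = 9}"

definition irrational_decimal :: "(nat \<Rightarrow> int) \<Rightarrow> bool" where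
  "irrational_decimal x \<longleftrightarrow>
     x \<in> decimals \<and> x \<notin> rational_decimals \<and> x \<notin> nines_decimals"

lemma floor_of_int_div_of_nat: "\<lfloor>(of_int a / of_nat p :: rat)\<rfloor> = a div int p"
  using floor_divide_of_int_eq[of a "int p", where ?'a = rat] by simp

lemma ldiv_rem_bounds:
  assumes "p \<ge> 1"
  shows "0 \<le> ldiv_rem q p k \<and> ldiv_rem q p k < int p"
proof -
  have *: "a - \<lfloor>(of_int a / of_nat p :: rat)\<rfloor> * int p = a mod int p" for a
    unfolding floor_of_int_div_of_nat by (simp add: minus_div_mult_eq_mod)
  have "\<exists>a. ldiv_rem q p k = a mod int p"
    by (cases k) (auto simp: * simp del: of_int_mult of_int_diff)
  then show ?thesis
    using assms by auto
qed

lemma rational_decimals_subset: "rational_decimals \<subseteq> decimals"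
proof -
  have "ldiv_digit q p (Suc k) \<in> {0..9}" if "p \<ge> 1" for q p k
  proof -
    have b: "0 \<le> ldiv_rem q p k" "ldiv_rem q p k < int p"
      using ldiv_rem_bounds[OF that] by auto
    have "\<not> 10 \<le> 10 * ldiv_rem q p k div int p"
    proof
      assume "10 \<le> 10 * ldiv_rem q p k div int p"
      then have "10 * int p \<le> 10 * ldiv_rem q p k div int p * int p"
        by (intro mult_right_mono) auto
      also have "\<dots> \<le> 10 * ldiv_rem q p k"
        using that pos_mod_sign[of "int p" "10 * ldiv_rem q p k"]
          div_mult_mod_eq[of "10 * ldiv_rem q p k" "int p"] by linarith
      finally show False
        using b by linarith
    qed
    then have "10 * ldiv_rem q p k div int p \<le> 9"
      by linarith
    moreover have "0 \<le> 10 * ldiv_rem q p k div int p"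
      using b that by (simp add: pos_imp_zdiv_nonneg_iff)
    ultimately show ?thesis
      by (auto simp only: ldiv_digit.simps floor_of_int_div_of_nat atLeastAtMost_iff)
  qed
  then have "ldiv_digit q p k \<in> {0..9}" if "p \<ge> 1" "k \<ge> 1" for q p k
    using that by (cases k) (auto simp del: ldiv_digit.simps atLeastAtMost_iff)
  then show ?thesis
    unfolding rational_decimals_def decimals_def by blast
qed

lemma ldiv_digit_cong:
  assumes "p \<ge> 1" "p' \<ge> 1" "(of_int q / of_nat p :: rat) = of_int q' / of_nat p'"
  shows "ldiv_digit q p = ldiv_digit q' p'"
proof -
  have "ldiv_digit q p k = ldiv_digit q' p' k \<and>
        (of_int (ldiv_rem q p k) / of_nat p :: rat) = of_int (ldiv_rem q' p' k) / of_nat p'" for k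
  proof (induction k)
    case 0
    then show ?case using assms by (simp add: diff_divide_distrib)
  next
    case (Suc k)
    then have e: "(of_int (10 * ldiv_rem q p k) / of_nat p :: rat)
                  = of_int (10 * ldiv_rem q' p' k) / of_nat p'"
      by (metis of_int_mult times_divide_eq_right)
    then have "ldiv_digit q p (Suc k) = ldiv_digit q' p' (Suc k)"
      by simp
    with e show ?case
      using assms by (simp add: diff_divide_distrib del: ldiv_digit.simps)
  qed
  then show ?thesis by blast
qed

end

theory Submission
  imports Defs
begin

text \<open>
  The remainders of a long division by \<open>p\<close> lie in the finite set \<open>{0..<p}\<close>, so one of them recurs,
  and from then on the digits recur as well. Conversely, let \<open>x\<close> recur with period \<open>s\<close> after place
  \<open>m\<close>, and let \<open>N\<^sub>k\<close> be the integer with the digits \<open>x\<^sub>0\<dots>x\<^sub>k\<close>. The geometric series suggests the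
  value \<open>q/p\<close> with \<open>q = N\<^sub>m\<^sub>+\<^sub>s - N\<^sub>m\<close> and \<open>p = 10\<^sup>m(10\<^sup>s - 1)\<close>. The candidate remainders
  \<open>t\<^sub>k = 10\<^sup>kq - N\<^sub>kp\<close> satisfy the recursion of long division and recur after \<open>m\<close>. A negative \<open>t\<^sub>k\<close>
  would make the sequence strictly decreasing from there on, against recurrence, and \<open>t\<^sub>k \<ge> p\<close> would
  make it increasing, hence constant from some place on, which forces all later digits to be 9.
  Otherwise \<open>0 \<le> t\<^sub>k < p\<close> for all \<open>k\<close>, and then the \<open>x\<^sub>k\<close> are the digits of \<open>q/p\<close>.
\<close>

lemma ldiv_digit_Suc: "ldiv_digit q p (Suc k) = 10 * ldiv_rem q p k div int p"
  by (simp only: ldiv_digit.simps floor_of_int_div_of_nat)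

lemma ldiv_rem_Suc: "ldiv_rem q p (Suc k) = 10 * ldiv_rem q p k mod int p"
  by (simp only: ldiv_rem.simps ldiv_digit_Suc minus_div_mult_eq_mod)

text \<open>Each remainder depends only on the preceding one, by
  \<open>ldiv_rem_Suc\<close>.\<close>

lemma ldiv_rem_add_cong:
  "ldiv_rem q p i = ldiv_rem q p j \<Longrightarrow> ldiv_rem q p (i + n) = ldiv_rem q p (j + n)"
  by (induction n) (simp_all only: add_0_right add_Suc_right ldiv_rem_Suc)

lemma ldiv_rem_recurs:
  assumes "p \<ge> 1"
  obtains i j where "i < j" "ldiv_rem q p i = ldiv_rem q p j"
proof -
  have "range (ldiv_rem q p) \<subseteq> {0..<int p}"
    using ldiv_rem_bounds[OF assms] by auto
  then have "finite (range (ldiv_rem q p))"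
    using finite_subset by blast
  then have "\<not> inj (ldiv_rem q p)"
    using finite_imageD infinite_UNIV_nat by blast
  then obtain i j where "i \<noteq> j" "ldiv_rem q p i = ldiv_rem q p j"
    unfolding inj_def by blast
  then show thesis
    using that by (metis linorder_neqE_nat)
qed

lemma rational_decimals_periodic:
  assumes "x \<in> rational_decimals"
  shows "\<exists>m s. s \<ge> 1 \<and> (\<forall>k>m. x (k + s) = x k)"
proof -
  obtain q p where x: "x = ldiv_digit q p" and p: "p \<ge> 1"
    using assms unfolding rational_decimals_def by blast
  obtain i j where ij: "i < j" "ldiv_rem q p i = ldiv_rem q p j"
    using ldiv_rem_recurs[OF p] .
  have "x (k + (j - i)) = x k" if "k > i" for k
  proof -
    obtain n where k: "k = Suc (i + n)"
      using \<open>k > i\<close> less_iff_Suc_add by blast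
    then have "k + (j - i) = Suc (j + n)"
      using ij(1) by simp
    then show ?thesis
      using ldiv_rem_add_cong[OF ij(2), of n] by (simp only: x k ldiv_digit_Suc)
  qed
  then show ?thesis
    using ij(1) by (intro exI[of _ i] exI[of _ "j - i"]) auto
qed

text \<open>By uniqueness of division with remainder, the bounds force each digit to be a quotient
  and each \<open>t k\<close> a remainder.\<close>

lemma ldiv_unique:
  assumes x0: "x 0 * int p + t 0 = q"
    and step: "\<And>k. 10 * t k = x (Suc k) * int p + t (Suc k)"
    and bounds: "\<And>k. 0 \<le> t k" "\<And>k. t k < int p"
  shows "x = ldiv_digit q p"
proof -
  have digit: "(y * int p + t k) div int p = y" "(y * int p + t k) mod int p = t k" for y k
    using bounds(1)[of k] bounds(2)[of k] by simp_all
  have rem: "ldiv_rem q p k = t k" for k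
  proof (induction k)
    case 0
    show ?case
      by (simp only: ldiv_rem.simps ldiv_digit.simps floor_of_int_div_of_nat
          minus_div_mult_eq_mod x0[symmetric] digit)
  next
    case (Suc k)
    then show ?case
      by (simp only: ldiv_rem_Suc step digit)
  qed
  have "x k = ldiv_digit q p k" for k
  proof (cases k)
    case 0
    then show ?thesis
      by (simp only: ldiv_digit.simps floor_of_int_div_of_nat x0[symmetric] digit)
  next
    case (Suc n)
    then show ?thesis
      by (simp only: ldiv_digit_Suc rem step digit)
  qed
  then show ?thesis
    by blast
qed

text \<open>These are the \<open>N\<^sub>k\<close> from above; a negative \<open>x 0\<close> keeps
  its sign, while later digits are still added.\<close>

fun decimal_prefix :: "(nat \<Rightarrow> int) \<Rightarrow> nat \<Rightarrow> int" where
  "decimal_prefix x 0 = x 0"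
| "decimal_prefix x (Suc k) = 10 * decimal_prefix x k + x (Suc k)"

lemma periodic_remainders_bounded:
  fixes x t :: "nat \<Rightarrow> int" and p :: int
  assumes x: "x \<in> decimals" "x \<notin> nines_decimals"
    and p: "p > 0"
    and step: "\<And>k. 10 * t k = x (Suc k) * p + t (Suc k)"
    and s: "s \<ge> 1" and periodic: "\<And>k. k \<ge> m \<Longrightarrow> t (k + s) = t k"
  shows "0 \<le> t k \<and> t k < p"
proof -
  have "0 \<le> x (Suc k)" "x (Suc k) \<le> 9" for k
    using x(1) unfolding decimals_def by auto
  then have xp: "0 \<le> x (Suc k) * p" "x (Suc k) * p \<le> 9 * p" for k
    using p by (auto intro: mult_right_mono)
  have "\<not> t k < 0"
  proof
    assume neg: "t k < 0"
    have decr: "t (i + n) \<le> t i - int n" if "t i < 0" for i n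
    proof (induction n)
      case (Suc n)
      then show ?case
        using that step[of "i + n"] xp(1)[of "i + n"] by simp
    qed simp
    \<comment> \<open>The shift by \<open>m\<close> reaches the range where \<open>t\<close> is
      periodic.\<close>
    have "t (k + m) < 0"
      using decr[OF neg, of m] neg by linarith
    from decr[OF this, of s] show False
      using periodic[of "k + m"] s by simp
  qed
  moreover have "\<not> p \<le> t k"
  proof
    assume big: "p \<le> t k"
    have ge: "p \<le> t (k + n)" for n
    proof (induction n)
      case (Suc n)
      then show ?case
        using step[of "k + n"] xp(2)[of "k + n"] by simp
    qed (use big in simp)
    have incr: "t (k + n) \<le> t (k + Suc n)" for n
      using step[of "k + n"] xp(2)[of "k + n"] ge[of n] by simp
    have "x i = 9" if "i > k + m" for i
    proof -
      obtain n where i: "i = Suc (k + n)" and n: "n \<ge> m"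
        using less_imp_Suc_add[OF \<open>i > k + m\<close>] by (metis add.assoc le_add1)
      \<comment> \<open>Over a full period a monotone sequence returns to its value, so it is
        constant in between.\<close>
      have "t (k + Suc n) \<le> t (k + (n + s))"
        using s by (intro lift_Suc_mono_le[of "\<lambda>n. t (k + n)", OF incr]) simp
      also have "\<dots> = t (k + n)"
        using periodic[of "k + n"] n by (simp add: add.assoc)
      finally have "t (k + Suc n) = t (k + n)"
        using incr[of n] by simp
      \<comment> \<open>Constancy gives \<open>x i * p = 9 * t (k + n)\<close>, which is at least
        \<open>9 * p\<close>.\<close>
      then have "x i * p = 9 * p"
        using step[of "k + n"] xp(2)[of "k + n"] ge[of n]
        unfolding i add_Suc_right by linarith
      then show ?thesis
        using p by simp
    qed
    then show False
      using x unfolding nines_decimals_def by blast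
  qed
  ultimately show ?thesis
    by simp
qed

lemma periodic_imp_rational:
  assumes x: "x \<in> decimals" "x \<notin> nines_decimals"
    and s: "s \<ge> 1" and periodic: "\<forall>k>m. x (k + s) = x k"
  shows "x \<in> rational_decimals"
proof -
  define p :: nat where "p = 10 ^ m * (10 ^ s - 1)"
  define q where "q = decimal_prefix x (m + s) - decimal_prefix x m"
  define t where "t k = 10 ^ k * q - decimal_prefix x k * int p" for k
  have "(10::nat) ^ s > 1"
    using s by (intro one_less_power) auto
  then have p: "p \<ge> 1"
    by (simp add: p_def)
  have p_int: "int p = 10 ^ m * (10 ^ s - 1)"
    by (simp add: p_def of_nat_diff)
  have rec: "10 * t k = x (Suc k) * int p + t (Suc k)" for k
    by (simp add: t_def algebra_simps)
  have t_periodic: "t (k + s) = t k" if "k \<ge> m" for k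
    using that
  proof (induction k rule: dec_induct)
    case base
    \<comment> \<open>The difference \<open>t (m + s) - t m\<close> is
      \<open>p * q - q * p\<close>.\<close>
    show ?case
      by (simp add: t_def p_int q_def algebra_simps power_add)
  next
    case (step k)
    then have "x (Suc k + s) = x (Suc k)"
      using periodic by (metis le_imp_less_Suc)
    then show ?case
      using step.IH rec[of k] rec[of "k + s"] by simp
  qed
  have bounds: "0 \<le> t k \<and> t k < int p" for k
    using periodic_remainders_bounded[OF x _ rec s t_periodic] p by simp
  have "x 0 * int p + t 0 = q"
    by (simp add: t_def)
  then have "x = ldiv_digit q p"
    using ldiv_unique rec bounds by blast
  then show ?thesis
    using p unfolding rational_decimals_def by blast
qed

theorem theorem8p2:
  fixes x :: "nat \<Rightarrow> int"
  assumes "x \<in> decimals"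
  shows "irrational_decimal x \<longleftrightarrow>
    \<not> (\<exists>m s :: nat. s \<ge> 1 \<and> (\<forall>k>m. x (k + s) = x k))"
proof -
  have "\<exists>m s :: nat. s \<ge> 1 \<and> (\<forall>k>m. x (k + s) = x k)" if "x \<in> nines_decimals"
  proof -
    obtain m where "\<forall>k>m. x k = 9"
      using \<open>x \<in> nines_decimals\<close> unfolding nines_decimals_def by blast
    then show ?thesis
      by (intro exI[of _ m] exI[of _ 1]) simp
  qed
  then show ?thesis
    using assms rational_decimals_periodic periodic_imp_rational
    unfolding irrational_decimal_def by blast
qed

end
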